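(* Let $\theta$ be a $C^0$ flow on a locally compact, separable metric space $M$, displaying uncountably many compact minimal sets. Then there is a countable (possibly empty) set $\mathfrak I\subset\mathrm{CMin}(M)$ such that: I. $\mathfrak D:=\mathrm{CMin}(M)\setminus\mathfrak I$ is a $\mathfrak c$-dense in itself and $d_H$-closed subset of $\mathrm{CMin}(M)$, having the cardinal of the continuum. II. $\mathfrak I$ is the set of all $X\in\mathrm{CMin}(M)$ having a neighbourhood (in $M$) containing only countably many (possibly one) compact minimal sets; hence $\mathfrak D$ is the largest $\mathfrak c$-dense in itself subset of $\mathrm{CMin}(M)$.
   Context: A $C^0$ flow is a continuous action of $(\mathbb R,+)$ on $M$. A minimal set is a nonvoid, closed, invariant set (union of orbits) containing no proper subset with these properties. $\mathrm{CMin}(M)$ is the set of compact minimal sets of the flow, endowed with the Hausdorff metric $d_H$; the prefix $d_H$- refers to this metric. A neighbourhood of a set is a set whose interior contains it. A set $\mathfrak C$ of nonvoid compact subsets of $M$ is $\mathfrak c$-dense in itself if for every $\Lambda\in\mathfrak C$ and $\epsilon>0$, $\#\{Y\in\mathfrak C:d_H(\Lambda,Y)<\epsilon\}\ge\mathfrak c$, where $\mathfrak c$ is the cardinal of the continuum. Countable includes finite and empty. *)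

theory Defs
  imports "HOL-Analysis.Analysis"
begin

definition C0_flow :: "(real \<Rightarrow> 'a::metric_space \<Rightarrow> 'a) \<Rightarrow> bool" where
  "C0_flow \<theta> \<longleftrightarrow>
     continuous_on UNIV (\<lambda>(t, x). \<theta> t x) \<and>
     (\<forall>x. \<theta> 0 x = x) \<and>
     (\<forall>s t x. \<theta> (s + t) x = \<theta> s (\<theta> t x))"

definition orbit :: "(real \<Rightarrow> 'a \<Rightarrow> 'a) \<Rightarrow> 'a \<Rightarrow> 'a set" where
  "orbit \<theta> x = range (\<lambda>t. \<theta> t x)"

definition invariant_set :: "(real \<Rightarrow> 'a \<Rightarrow> 'a) \<Rightarrow> 'a set \<Rightarrow> bool" where
  "invariant_set \<theta> A \<longleftrightarrow> (\<exists>B. A = (\<Union>x\<in>B. orbit \<theta> x))"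

definition minimal_set :: "(real \<Rightarrow> 'a::metric_space \<Rightarrow> 'a) \<Rightarrow> 'a set \<Rightarrow> bool" where
  "minimal_set \<theta> A \<longleftrightarrow>
     A \<noteq> {} \<and> closed A \<and> invariant_set \<theta> A \<and>
     \<not> (\<exists>B. B \<subset> A \<and> B \<noteq> {} \<and> closed B \<and> invariant_set \<theta> B)"

definition CMin :: "(real \<Rightarrow> 'a::metric_space \<Rightarrow> 'a) \<Rightarrow> 'a set set" where
  "CMin \<theta> = {A. compact A \<and> minimal_set \<theta> A}"

definition nonvoid_compacts :: "'a::metric_space set set" where
  "nonvoid_compacts = {A. compact A \<and> A \<noteq> {}}"

text \<open>
  The value 0 off the nonvoid compact sets is a dummy: the locale
  \<^locale>\<open>Metric_space\<close> requires nonnegativity and symmetry on the whole type, while a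
  real supremum over an empty or unbounded family is unspecified.
\<close>

definition hausdorff_dist :: "'a::metric_space set \<Rightarrow> 'a set \<Rightarrow> real" where
  "hausdorff_dist A B =
     (if A \<in> nonvoid_compacts \<and> B \<in> nonvoid_compacts
      then max (SUP x\<in>A. infdist x B) (SUP y\<in>B. infdist y A)
      else 0)"

definition c_dense_in_itself :: "'a::metric_space set set \<Rightarrow> bool" where
  "c_dense_in_itself C \<longleftrightarrow>
     C \<subseteq> nonvoid_compacts \<and>
     (\<forall>L\<in>C. \<forall>e>0. (UNIV :: real set) \<lesssim> {Y \<in> C. hausdorff_dist L Y < e})"

definition neighbourhood_of :: "'a::topological_space set \<Rightarrow> 'a set \<Rightarrow> bool" where
  "neighbourhood_of N X \<longleftrightarrow> X \<subseteq> interior N"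

lemma hausdorff_dist_le_iff:
  assumes A: "A \<in> nonvoid_compacts" and B: "B \<in> nonvoid_compacts"
  shows "hausdorff_dist A B \<le> r \<longleftrightarrow>
    (\<forall>x\<in>A. infdist x B \<le> r) \<and> (\<forall>y\<in>B. infdist y A \<le> r)"
proof -
  have bdd: "bdd_above ((\<lambda>x. infdist x T) ` S)" if "S \<in> nonvoid_compacts" for S T :: "'a set"
  proof -
    have "compact ((\<lambda>x. infdist x T) ` S)"
      using that by (intro compact_continuous_image continuous_intros)
        (auto simp: nonvoid_compacts_def)
    then show ?thesis
      by (simp add: bounded_imp_bdd_above compact_imp_bounded)
  qed
  have ne: "A \<noteq> {}" "B \<noteq> {}"
    using A B by (auto simp: nonvoid_compacts_def)
  show ?thesis
    using A B by (simp add: hausdorff_dist_def cSUP_le_iff bdd ne)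
qed

lemma Metric_space_hausdorff_dist:
  "Metric_space (nonvoid_compacts :: 'a::metric_space set set) hausdorff_dist"
proof
  fix A B C :: "'a set"
  show nonneg: "0 \<le> hausdorff_dist A B" for A B :: "'a set"
  proof (cases "A \<in> nonvoid_compacts \<and> B \<in> nonvoid_compacts")
    case True
    then obtain x where "x \<in> A"
      by (auto simp: nonvoid_compacts_def)
    then have "infdist x B \<le> hausdorff_dist A B"
      using hausdorff_dist_le_iff[of A B "hausdorff_dist A B"] True by blast
    then show ?thesis
      using infdist_nonneg[of x B] by linarith
  next
    case False
    then show ?thesis
      by (auto simp: hausdorff_dist_def)
  qed
  show "hausdorff_dist A B = hausdorff_dist B A"
    by (simp add: hausdorff_dist_def max.commute conj_commute)
  assume A: "A \<in> nonvoid_compacts" and B: "B \<in> nonvoid_compacts"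
  have ne: "A \<noteq> {}" "B \<noteq> {}" and cl: "closed A" "closed B"
    using A B by (auto simp: nonvoid_compacts_def compact_imp_closed)
  show "(hausdorff_dist A B = 0) = (A = B)"
  proof -
    have "hausdorff_dist A B = 0 \<longleftrightarrow> hausdorff_dist A B \<le> 0"
      using nonneg[of A B] by linarith
    also have "\<dots> \<longleftrightarrow> (\<forall>x\<in>A. infdist x B = 0) \<and> (\<forall>y\<in>B. infdist y A = 0)"
      using hausdorff_dist_le_iff[OF A B] infdist_nonneg by (metis order_antisym order_refl)
    also have "\<dots> \<longleftrightarrow> A = B"
      using in_closed_iff_infdist_zero[OF cl(1) ne(1)] in_closed_iff_infdist_zero[OF cl(2) ne(2)]
      by auto
    finally show ?thesis .
  qed
  assume C: "C \<in> nonvoid_compacts"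
  have key: "infdist x T \<le> infdist x S + r"
    if "S \<in> nonvoid_compacts" and "\<forall>y\<in>S. infdist y T \<le> r" for x r and S T :: "'a set"
  proof -
    have "S \<noteq> {}"
      using that by (auto simp: nonvoid_compacts_def)
    moreover have "infdist x T - r \<le> dist x y" if "y \<in> S" for y
    proof -
      have "infdist x T \<le> infdist y T + dist x y"
        by (rule infdist_triangle)
      with that \<open>\<forall>y\<in>S. infdist y T \<le> r\<close> show ?thesis by force
    qed
    ultimately have "infdist x T - r \<le> infdist x S"
      by (auto simp: infdist_notempty intro: cINF_greatest)
    then show ?thesis by simp
  qed
  have AB: "\<forall>x\<in>A. infdist x B \<le> hausdorff_dist A B" "\<forall>y\<in>B. infdist y A \<le> hausdorff_dist A B"
    using hausdorff_dist_le_iff[OF A B, of "hausdorff_dist A B"] by auto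
  have BC: "\<forall>x\<in>B. infdist x C \<le> hausdorff_dist B C" "\<forall>y\<in>C. infdist y B \<le> hausdorff_dist B C"
    using hausdorff_dist_le_iff[OF B C, of "hausdorff_dist B C"] by auto
  show "hausdorff_dist A C \<le> hausdorff_dist A B + hausdorff_dist B C"
    unfolding hausdorff_dist_le_iff[OF A C]
  proof (intro conjI ballI)
    show "infdist x C \<le> hausdorff_dist A B + hausdorff_dist B C" if "x \<in> A" for x
      using bspec[OF AB(1) that] key[OF B BC(1), of x] by linarith
    show "infdist y A \<le> hausdorff_dist A B + hausdorff_dist B C" if "y \<in> C" for y
      using bspec[OF BC(2) that] key[OF B AB(2), of y] by linarith
  qed
qed

lemma Metric_space_CMin: "Metric_space (CMin \<theta>) hausdorff_dist"
proof -
  have "CMin \<theta> \<subseteq> nonvoid_compacts"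
    by (auto simp: CMin_def minimal_set_def nonvoid_compacts_def)
  then show ?thesis
    using Metric_space.subspace[OF Metric_space_hausdorff_dist] by blast
qed

end

theory Submission
  imports Defs
begin

text \<open>
  Everything rests on comparing the Hausdorff metric on compact minimal sets with inclusion in
  open sets. Every orbit in a minimal set \<open>X\<close> is dense in \<open>X\<close>, so an orbit that starts close to
  \<open>X\<close> comes close to every point of \<open>X\<close>. Hence a compact minimal set contained in a small open
  neighbourhood of \<open>X\<close> is automatically Hausdorff-close to \<open>X\<close>
  (\<open>CMin_close_if_subset_open\<close>); conversely, sets that are Hausdorff-close to a compact set lie in
  any prescribed neighbourhood of it (\<open>hausdorff_ball_subset_open\<close>). All questions about
  Hausdorff balls thus become questions about the minimal sets contained in an open set.

  Let \<open>I\<close> be the set of compact minimal sets with a neighbourhood containing only countably many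
  of them (\<open>sparse_CMin\<close> below), and \<open>D\<close> its complement. The space has a countable base, and a
  compact set can be separated from the complement of a neighbourhood by a finite union of basic
  sets; there are countably many such unions, so \<open>I\<close> is a countable union of countable sets.
  By the comparison above, a member of \<open>I\<close> has a Hausdorff ball which consists of
  countably many minimal sets, all in \<open>I\<close>. So \<open>D\<close> is closed, and no member of \<open>I\<close> belongs to a
  \<open>c\<close>-dense in itself family of compact minimal sets.

  What remains is to pass from uncountably many to continuum many minimal sets near a member of
  \<open>D\<close> (\<open>real_lepoll_CMin_rich\<close>). A compact set whose interior contains uncountably many minimal
  sets contains two different ones that belong to \<open>D\<close>; they are disjoint, and have disjoint
  compact neighbourhoods, each again with uncountably many minimal sets in its interior. Iteration
  gives a binary tree of compact sets. A branch of this tree need not shrink to a minimal set,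
  but its intersection contains one: along the branch, the largest invariant subsets form a
  decreasing sequence of nonempty compact sets, and the intersection of these is a nonempty
  compact invariant set, which contains a minimal set by Zorn's lemma. Different branches have
  disjoint intersections, so there are at least as many minimal sets as branches. Removing
  the countable set \<open>I\<close> leaves continuum many of them. There are at most
  continuum many minimal sets altogether, because they are pairwise disjoint and nonempty.
\<close>

section \<open>Countable bases and cardinals\<close>

lemma separable_imp_countable_base:
  assumes "separable_space (euclidean :: 'a::metric_space topology)"
  obtains \<B> :: "'a::metric_space set set" where "countable \<B>" "\<And>B. B \<in> \<B> \<Longrightarrow> open B"
    "\<And>S x. open S \<Longrightarrow> x \<in> S \<Longrightarrow> \<exists>B\<in>\<B>. x \<in> B \<and> B \<subseteq> S"
proof -
  obtain C :: "'a set" where "countable C" and C: "closure C = UNIV"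
    using assms by (auto simp: separable_space_def)
  let ?\<B> = "(\<lambda>(c, n). ball c (inverse (real (Suc n)))) ` (C \<times> UNIV)"
  show thesis
  proof
    show "countable ?\<B>"
      using \<open>countable C\<close> by (intro countable_image countable_SIGMA) auto
    show "open B" if "B \<in> ?\<B>" for B
      using that by auto
    show "\<exists>B\<in>?\<B>. x \<in> B \<and> B \<subseteq> S" if "open S" "x \<in> S" for S x
    proof -
      obtain e where "e > 0" and e: "ball x e \<subseteq> S"
        using \<open>open S\<close> \<open>x \<in> S\<close> openE by blast
      obtain n where n: "inverse (real (Suc n)) < e / 2"
        using reals_Archimedean[of "e / 2"] \<open>e > 0\<close> by auto
      obtain c where "c \<in> C" and c: "dist c x < inverse (real (Suc n))"
        using C closure_approachable[of x C] by (metis UNIV_I inverse_positive_iff_positive of_nat_0_less_iff zero_less_Suc)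
      have "ball c (inverse (real (Suc n))) \<subseteq> ball x e"
      proof
        fix y assume "y \<in> ball c (inverse (real (Suc n)))"
        then have "dist x y < e"
          using dist_triangle[of x y c] c n by (simp add: dist_commute)
        then show "y \<in> ball x e" by simp
      qed
      then show ?thesis
        using e c \<open>c \<in> C\<close> by (intro bexI[of _ "ball c (inverse (real (Suc n)))"]) auto
    qed
  qed
qed

text \<open>
  In a \<open>T1\<close> space a point is determined by the basic open sets that contain it, hence by a set of
  indices of an enumeration of the base.
\<close>

lemma second_countable_lepoll_real:
  fixes \<B> :: "'a::t1_space set set"
  assumes "countable \<B>" and base: "\<And>S x. open S \<Longrightarrow> x \<in> S \<Longrightarrow> \<exists>B\<in>\<B>. x \<in> B \<and> B \<subseteq> S"
  shows "(UNIV :: 'a set) \<lesssim> (UNIV :: real set)"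
proof -
  let ?f = "\<lambda>x. {n. x \<in> from_nat_into \<B> n}"
  have "inj ?f"
  proof (rule injI, rule ccontr)
    fix x y :: 'a
    assume eq: "?f x = ?f y" and "x \<noteq> y"
    then obtain S where "open S" "x \<in> S" "y \<notin> S"
      using t1_space by blast
    then obtain B where "B \<in> \<B>" "x \<in> B" "y \<notin> B"
      using base by blast
    then obtain n where "from_nat_into \<B> n = B"
      using from_nat_into_surj[OF \<open>countable \<B>\<close>] by metis
    then show False
      using eq \<open>x \<in> B\<close> \<open>y \<notin> B\<close> by blast
  qed
  then have "(UNIV :: 'a set) \<lesssim> (UNIV :: nat set set)"
    by (auto simp: lepoll_def)
  then show ?thesis
    using lepoll_trans2 nat_sets_eqpoll_reals by blast
qed

text \<open>
  Since \<open>S - I\<close> is still infinite, it absorbs the countable set \<open>I\<close>: adding \<open>I\<close> back does not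
  change its cardinality.
\<close>

lemma real_lepoll_minus_countable:
  assumes "(UNIV :: real set) \<lesssim> S" "countable I"
  shows "(UNIV :: real set) \<lesssim> S - I"
proof -
  have "uncountable S"
    using assms(1) countable_lepoll uncountable_UNIV_real by blast
  then have "infinite (S - I)"
    using \<open>countable I\<close> countable_finite uncountable_minus_countable by blast
  moreover have "I \<lesssim> (UNIV :: nat set)"
    using \<open>countable I\<close> by (auto simp: countable_def lepoll_def)
  ultimately have "I \<lesssim> S - I"
    using infinite_le_lepoll lepoll_trans by blast
  then have I: "(card_of I, card_of (S - I)) \<in> ordLeq"
    by (simp add: card_of_ordLeq[symmetric] lepoll_def)
  have "(card_of ((S - I) \<union> I), card_of (S - I)) \<in> ordLeq"
    using \<open>infinite (S - I)\<close>
    by (intro card_of_Un_ordLeq_infinite_Field[OF _ _ I] card_of_Card_order card_of_mono1)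
       (simp_all add: Field_card_of)
  then have "(S - I) \<union> I \<lesssim> S - I"
    by (simp add: card_of_ordLeq[symmetric] lepoll_def)
  moreover have "S \<lesssim> (S - I) \<union> I"
    by (intro subset_imp_lepoll) blast
  ultimately show ?thesis
    using assms(1) lepoll_trans by blast
qed

section \<open>Invariant sets and minimal sets\<close>

lemma invariant_set_iff:
  assumes "C0_flow \<theta>"
  shows "invariant_set \<theta> A \<longleftrightarrow> (\<forall>x\<in>A. \<forall>t. \<theta> t x \<in> A)"
proof
  assume "invariant_set \<theta> A"
  then obtain B where B: "A = (\<Union>x\<in>B. orbit \<theta> x)"
    by (auto simp: invariant_set_def)
  show "\<forall>x\<in>A. \<forall>t. \<theta> t x \<in> A"
  proof (intro ballI allI)
    fix x t assume "x \<in> A"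
    then obtain b s where "b \<in> B" "x = \<theta> s b"
      using B by (auto simp: orbit_def)
    then have "\<theta> t x = \<theta> (t + s) b"
      using assms by (simp add: C0_flow_def)
    then show "\<theta> t x \<in> A"
      using B \<open>b \<in> B\<close> by (auto simp: orbit_def)
  qed
next
  assume A: "\<forall>x\<in>A. \<forall>t. \<theta> t x \<in> A"
  have "x \<in> orbit \<theta> x" for x
    using assms unfolding orbit_def C0_flow_def by (metis rangeI)
  then have "A = (\<Union>x\<in>A. orbit \<theta> x)"
    using A by (auto simp: orbit_def)
  then show "invariant_set \<theta> A"
    unfolding invariant_set_def by blast
qed

lemma continuous_on_time_map:
  assumes "C0_flow \<theta>"
  shows "continuous_on UNIV (\<theta> t)"
proof -
  have "continuous_on UNIV ((\<lambda>(t, x). \<theta> t x) \<circ> (\<lambda>x. (t, x)))"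
    using assms by (intro continuous_on_compose continuous_intros)
      (auto simp: C0_flow_def intro: continuous_on_subset)
  then show ?thesis
    by (simp add: comp_def)
qed

text \<open>
  The largest invariant subset, as \<open>invariant_set_core\<close> and \<open>invariant_subset_core\<close> show.
\<close>

definition invariant_core :: "(real \<Rightarrow> 'a \<Rightarrow> 'a) \<Rightarrow> 'a set \<Rightarrow> 'a set" where
  "invariant_core \<theta> K = {x. \<forall>t. \<theta> t x \<in> K}"

lemma invariant_core_subset:
  assumes "C0_flow \<theta>"
  shows "invariant_core \<theta> K \<subseteq> K"
  using assms unfolding C0_flow_def invariant_core_def by (metis (mono_tags, lifting) mem_Collect_eq subsetI)

lemma invariant_set_core:
  assumes "C0_flow \<theta>"
  shows "invariant_set \<theta> (invariant_core \<theta> K)"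
proof -
  have "\<theta> s (\<theta> t x) = \<theta> (s + t) x" for s t x
    using assms by (simp add: C0_flow_def)
  then show ?thesis
    by (auto simp: invariant_set_iff[OF assms] invariant_core_def)
qed

lemma invariant_subset_core:
  assumes "C0_flow \<theta>" "invariant_set \<theta> A" "A \<subseteq> K"
  shows "A \<subseteq> invariant_core \<theta> K"
  using assms by (auto simp: invariant_set_iff invariant_core_def)

lemma closed_invariant_core:
  assumes "C0_flow \<theta>" "closed K"
  shows "closed (invariant_core \<theta> K)"
proof -
  have "invariant_core \<theta> K = (\<Inter>t. \<theta> t -` K)"
    by (auto simp: invariant_core_def)
  then show ?thesis
    using assms by (auto intro!: closed_vimage continuous_on_time_map)
qed

lemma CMinD:
  assumes "X \<in> CMin \<theta>"
  shows "compact X" "X \<noteq> {}" "closed X" "invariant_set \<theta> X" "X \<in> nonvoid_compacts"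
  using assms by (auto simp: CMin_def minimal_set_def nonvoid_compacts_def)

lemma CMin_subset_eq:
  assumes "X \<in> CMin \<theta>" "B \<subseteq> X" "B \<noteq> {}" "closed B" "invariant_set \<theta> B"
  shows "B = X"
  using assms unfolding CMin_def minimal_set_def by blast

lemma CMin_disjoint:
  assumes "C0_flow \<theta>" "X \<in> CMin \<theta>" "Y \<in> CMin \<theta>" "X \<noteq> Y"
  shows "X \<inter> Y = {}"
proof (rule ccontr)
  assume "X \<inter> Y \<noteq> {}"
  moreover have "closed (X \<inter> Y)"
    using assms CMinD by blast
  moreover have "invariant_set \<theta> (X \<inter> Y)"
    using CMinD(4)[OF assms(2)] CMinD(4)[OF assms(3)]
    by (auto simp: invariant_set_iff[OF assms(1)])
  ultimately have "X \<inter> Y = X" "X \<inter> Y = Y"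
    using CMin_subset_eq[OF assms(2)] CMin_subset_eq[OF assms(3)] by auto
  then show False
    using \<open>X \<noteq> Y\<close> by simp
qed

text \<open>
  Density of orbits in a minimal set: the points of \<open>X\<close> whose orbits avoid \<open>U\<close> form a closed
  invariant proper subset of \<open>X\<close>, which must be empty.
\<close>

lemma CMin_orbit_meets_open:
  assumes "C0_flow \<theta>" "X \<in> CMin \<theta>" "x \<in> X" "open U" "U \<inter> X \<noteq> {}"
  obtains t where "\<theta> t x \<in> U"
proof (rule ccontr)
  assume no: "\<not> thesis"
  let ?B = "X \<inter> invariant_core \<theta> (- U)"
  have "x \<in> ?B"
    using no that \<open>x \<in> X\<close> by (auto simp: invariant_core_def)
  moreover have "closed ?B"
    using assms by (intro closed_Int closed_invariant_core) (auto dest: CMinD)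
  moreover have "invariant_set \<theta> ?B"
    using CMinD(4)[OF assms(2)] invariant_set_core[OF assms(1), of "- U"]
    by (auto simp: invariant_set_iff[OF assms(1)])
  ultimately have "?B = X"
    using CMin_subset_eq[OF assms(2), of ?B] by blast
  then show False
    using invariant_core_subset[OF assms(1), of "- U"] \<open>U \<inter> X \<noteq> {}\<close> by blast
qed

text \<open>
  Zorn's lemma, applied to the complements of the nonempty closed invariant subsets of \<open>K\<close>, so that
  minimal sets become maximal elements; compactness makes the intersection of a chain nonempty.
\<close>

lemma exists_CMin_subset:
  assumes "C0_flow \<theta>" "compact K" "K \<noteq> {}" "invariant_set \<theta> K"
  obtains X where "X \<in> CMin \<theta>" "X \<subseteq> K"
proof -
  define \<A> where "\<A> = {U. - U \<subseteq> K \<and> - U \<noteq> {} \<and> open U \<and> invariant_set \<theta> (- U)}"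
  have "\<exists>M\<in>\<A>. \<forall>U\<in>\<A>. M \<subseteq> U \<longrightarrow> U = M"
  proof (rule subset_Zorn_nonempty)
    have "- K \<in> \<A>"
      using assms by (auto simp: \<A>_def compact_imp_closed open_Compl)
    then show "\<A> \<noteq> {}" by blast
    fix \<C> assume "\<C> \<noteq> {}" and ch: "subset.chain \<A> \<C>"
    then have sub: "\<C> \<subseteq> \<A>"
      by (simp add: subset.chain_def)
    have "K \<inter> (\<Inter>U\<in>\<C>. - U) \<noteq> {}"
    proof (rule compact_imp_fip_image[OF \<open>compact K\<close>])
      show "closed (- U)" if "U \<in> \<C>" for U
        using that sub by (auto simp: \<A>_def)
      fix \<F> assume "finite \<F>" "\<F> \<subseteq> \<C>"
      show "K \<inter> (\<Inter>U\<in>\<F>. - U) \<noteq> {}"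
      proof (cases "\<F> = {}")
        case False
        have "subset.chain \<A> \<F>"
          using ch \<open>\<F> \<subseteq> \<C>\<close> unfolding subset.chain_def by blast
        then have "\<Union>\<F> \<in> \<A>"
          using Union_in_chain[OF \<open>finite \<F>\<close> False] sub \<open>\<F> \<subseteq> \<C>\<close> by blast
        then have "- \<Union>\<F> \<subseteq> K" "- \<Union>\<F> \<noteq> {}"
          by (auto simp: \<A>_def)
        then obtain x where "x \<in> - \<Union>\<F>" "x \<in> K"
          by (metis ex_in_conv subsetD)
        then have "x \<in> K \<inter> (\<Inter>U\<in>\<F>. - U)"
          by blast
        then show ?thesis
          by blast
      qed (use \<open>K \<noteq> {}\<close> in simp)
    qed
    then have "- \<Union>\<C> \<noteq> {}"
      by blast
    moreover have "- \<Union>\<C> \<subseteq> K"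
      using sub \<open>\<C> \<noteq> {}\<close> by (force simp: \<A>_def)
    moreover have "open (\<Union>\<C>)"
      using sub by (auto simp: \<A>_def)
    moreover have "invariant_set \<theta> (- \<Union>\<C>)"
      using sub unfolding \<A>_def invariant_set_iff[OF assms(1)] by blast
    ultimately show "\<Union>\<C> \<in> \<A>"
      by (simp add: \<A>_def)
  qed
  then obtain M where M: "M \<in> \<A>" and max: "\<And>U. U \<in> \<A> \<Longrightarrow> M \<subseteq> U \<Longrightarrow> U = M"
    by blast
  have sub: "- M \<subseteq> K" and props: "- M \<noteq> {}" "closed (- M)" "invariant_set \<theta> (- M)"
    using M by (auto simp: \<A>_def)
  have "False" if B: "B \<subset> - M" "B \<noteq> {}" "closed B" "invariant_set \<theta> B" for B
  proof -
    have "- B \<in> \<A>"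
      using B sub by (auto simp: \<A>_def open_Compl)
    then have "- B = M"
      using max B by blast
    then show False
      using B by blast
  qed
  then have "minimal_set \<theta> (- M)"
    unfolding minimal_set_def using props by blast
  moreover have "compact (- M)"
    using \<open>compact K\<close> sub props(2) by (metis compact_Int_closed inf.absorb2)
  ultimately show thesis
    using that sub by (simp add: CMin_def)
qed

section \<open>Hausdorff neighbourhoods of a minimal set\<close>

lemma hausdorff_ball_subset_open:
  assumes "X \<in> nonvoid_compacts" "open V" "X \<subseteq> V"
  obtains e where "e > 0" "\<And>Y. Y \<in> nonvoid_compacts \<Longrightarrow> hausdorff_dist X Y < e \<Longrightarrow> Y \<subseteq> V"
proof -
  have X: "compact X" "X \<noteq> {}"
    using assms(1) by (auto simp: nonvoid_compacts_def)
  obtain e where "e > 0" and e: "(\<Union>x\<in>X. ball x e) \<subseteq> V"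
    using compact_subset_open_imp_ball_epsilon_subset[OF X(1) assms(2,3)] by blast
  show thesis
  proof
    show "Y \<subseteq> V" if Y: "Y \<in> nonvoid_compacts" "hausdorff_dist X Y < e" for Y
    proof
      fix y assume "y \<in> Y"
      then have "infdist y X < e"
        using hausdorff_dist_le_iff[OF assms(1) Y(1), of "hausdorff_dist X Y"] Y(2) by force
      then obtain x where "x \<in> X" "dist y x < e"
        using X(2) by (auto simp: infdist_notempty cInf_less_iff)
      then have "y \<in> ball x e"
        by (simp add: dist_commute)
      then show "y \<in> V"
        using e \<open>x \<in> X\<close> by blast
    qed
  qed fact
qed

text \<open>
  Being contained in a neighbourhood of \<open>X\<close> gives only one half of Hausdorff closeness; minimality of
  \<open>X\<close> supplies the other. Take a finite net in \<open>X\<close>. The points whose orbits pass near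
  every point of the net form an open set, which contains \<open>X\<close> by density of orbits. An
  invariant set that has a point there comes close to all of \<open>X\<close>.
\<close>

lemma CMin_close_if_subset_open:
  assumes flow: "C0_flow \<theta>" and X: "X \<in> CMin \<theta>" and "e > 0"
  obtains V where "open V" "X \<subseteq> V"
    "\<And>Y. Y \<in> CMin \<theta> \<Longrightarrow> Y \<subseteq> V \<Longrightarrow> hausdorff_dist X Y < e"
proof -
  \<comment> \<open>The distances below are bounded by \<open>2 * r\<close>, the radius of the net plus the distance of the
    orbit from the net; this has to be less than \<open>e\<close>.\<close>
  define r where "r = e / 4"
  have "r > 0"
    using \<open>e > 0\<close> by (simp add: r_def)
  obtain F where F: "finite F" "F \<subseteq> X" "X \<subseteq> (\<Union>z\<in>F. ball z r)"
    using compactE_image[OF CMinD(1)[OF X], of X "\<lambda>z. ball z r"] \<open>r > 0\<close> by force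
  define U where "U z = (\<Union>t. \<theta> t -` ball z r)" for z
  define V where "V = (\<Inter>z\<in>F. U z) \<inter> (\<Union>z\<in>X. ball z r)"
  show thesis
  proof
    have "open (U z)" for z
      unfolding U_def using continuous_on_time_map[OF flow] by (intro open_UN ballI open_vimage) auto
    then show "open V"
      unfolding V_def using F(1) by (intro open_Int open_INT open_UN) auto
    have "x \<in> U z" if xz: "x \<in> X" "z \<in> F" for x z
    proof -
      have "ball z r \<inter> X \<noteq> {}"
        using xz(2) F(2) \<open>r > 0\<close> by force
      then obtain t where "\<theta> t x \<in> ball z r"
        using CMin_orbit_meets_open[OF flow X xz(1) open_ball] by blast
      then show ?thesis
        by (auto simp: U_def)
    qed
    then show "X \<subseteq> V"
      using \<open>r > 0\<close> by (auto simp: V_def)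
    fix Y assume Y: "Y \<in> CMin \<theta>" "Y \<subseteq> V"
    obtain y where "y \<in> Y"
      using CMinD(2)[OF Y(1)] by blast
    have "infdist x Y \<le> 2 * r" if "x \<in> X" for x
    proof -
      obtain z where z: "z \<in> F" "dist z x < r"
        using F(3) \<open>x \<in> X\<close> by auto
      have "y \<in> U z"
        using Y(2) \<open>y \<in> Y\<close> z(1) by (auto simp: V_def)
      then obtain t where t: "dist z (\<theta> t y) < r"
        by (auto simp: U_def)
      have "\<theta> t y \<in> Y"
        using CMinD(4)[OF Y(1)] \<open>y \<in> Y\<close> by (simp add: invariant_set_iff[OF flow])
      then have "infdist x Y \<le> dist x (\<theta> t y)"
        by (rule infdist_le)
      also have "\<dots> \<le> dist x z + dist z (\<theta> t y)"
        by (rule dist_triangle)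
      also have "\<dots> \<le> 2 * r"
        using z(2) t by (simp add: dist_commute)
      finally show ?thesis .
    qed
    moreover have "infdist u X \<le> 2 * r" if "u \<in> Y" for u
    proof -
      obtain z where z: "z \<in> X" "dist z u < r"
        using Y(2) \<open>u \<in> Y\<close> by (auto simp: V_def)
      then have "infdist u X \<le> dist u z"
        using infdist_le by blast
      then show ?thesis
        using z(2) \<open>r > 0\<close> by (simp add: dist_commute)
    qed
    ultimately have "hausdorff_dist X Y \<le> 2 * r"
      using hausdorff_dist_le_iff[OF CMinD(5)[OF X] CMinD(5)[OF Y(1)]] by blast
    then show "hausdorff_dist X Y < e"
      using \<open>e > 0\<close> by (simp add: r_def)
  qed
qed

section \<open>Minimal sets with few minimal sets nearby\<close>

definition sparse_CMin :: "(real \<Rightarrow> 'a::metric_space \<Rightarrow> 'a) \<Rightarrow> 'a set set" where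
  "sparse_CMin \<theta> =
     {X \<in> CMin \<theta>. \<exists>N. neighbourhood_of N X \<and> countable {Y \<in> CMin \<theta>. Y \<subseteq> N}}"

lemma sparse_CMin_iff:
  "X \<in> sparse_CMin \<theta> \<longleftrightarrow>
     X \<in> CMin \<theta> \<and> (\<exists>V. open V \<and> X \<subseteq> V \<and> countable {Y \<in> CMin \<theta>. Y \<subseteq> V})"
proof
  assume "X \<in> sparse_CMin \<theta>"
  then obtain N where X: "X \<in> CMin \<theta>" "X \<subseteq> interior N" and N: "countable {Y \<in> CMin \<theta>. Y \<subseteq> N}"
    by (auto simp: sparse_CMin_def neighbourhood_of_def)
  have "countable {Y \<in> CMin \<theta>. Y \<subseteq> interior N}"
    by (rule countable_subset[OF _ N]) (use interior_subset in blast)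
  then show "X \<in> CMin \<theta> \<and> (\<exists>V. open V \<and> X \<subseteq> V \<and> countable {Y \<in> CMin \<theta>. Y \<subseteq> V})"
    using X open_interior by blast
next
  assume "X \<in> CMin \<theta> \<and> (\<exists>V. open V \<and> X \<subseteq> V \<and> countable {Y \<in> CMin \<theta>. Y \<subseteq> V})"
  then show "X \<in> sparse_CMin \<theta>"
    unfolding sparse_CMin_def neighbourhood_of_def using interior_open by (metis (mono_tags, lifting) mem_Collect_eq)
qed

text \<open>
  A neighbourhood that witnesses sparseness of \<open>X\<close> can be shrunk to a finite union of basic open
  sets, since \<open>X\<close> is compact. Countably many such unions serve all sparse minimal sets,
  and each serves only countably many.
\<close>

lemma countable_sparse_CMin:
  fixes \<theta> :: "real \<Rightarrow> 'a::metric_space \<Rightarrow> 'a"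
  assumes "separable_space (euclidean :: 'a topology)"
  shows "countable (sparse_CMin \<theta>)"
proof -
  obtain \<B> :: "'a set set" where \<B>: "countable \<B>" "\<And>B. B \<in> \<B> \<Longrightarrow> open B"
    and base: "\<And>S x. open S \<Longrightarrow> x \<in> S \<Longrightarrow> \<exists>B\<in>\<B>. x \<in> B \<and> B \<subseteq> S"
    using separable_imp_countable_base[OF assms] by blast
  define \<U> where "\<U> = {U \<in> Union ` {\<F>. finite \<F> \<and> \<F> \<subseteq> \<B>}. countable {Y \<in> CMin \<theta>. Y \<subseteq> U}}"
  have "countable \<U>"
    unfolding \<U>_def using countable_Collect_finite_subset[OF \<B>(1)]
    by (metis (no_types, lifting) countable_image countable_subset mem_Collect_eq subsetI)
  have "sparse_CMin \<theta> \<subseteq> (\<Union>U\<in>\<U>. {Y \<in> CMin \<theta>. Y \<subseteq> U})"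
  proof
    fix X assume "X \<in> sparse_CMin \<theta>"
    then obtain V where X: "X \<in> CMin \<theta>" and V: "open V" "X \<subseteq> V" "countable {Y \<in> CMin \<theta>. Y \<subseteq> V}"
      by (auto simp: sparse_CMin_iff)
    obtain \<F> where \<F>: "finite \<F>" "\<F> \<subseteq> {B \<in> \<B>. B \<subseteq> V}" "X \<subseteq> \<Union>\<F>"
    proof (rule compactE[OF CMinD(1)[OF X], of "{B \<in> \<B>. B \<subseteq> V}"])
      show "X \<subseteq> \<Union>{B \<in> \<B>. B \<subseteq> V}"
        using base[OF V(1)] V(2) by blast
    qed (use \<B>(2) in auto)
    have "countable {Y \<in> CMin \<theta>. Y \<subseteq> \<Union>\<F>}"
      by (rule countable_subset[OF _ V(3)]) (use \<F>(2) in blast)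
    then have "\<Union>\<F> \<in> \<U>"
      using \<F> by (auto simp: \<U>_def)
    then show "X \<in> (\<Union>U\<in>\<U>. {Y \<in> CMin \<theta>. Y \<subseteq> U})"
      using X \<F>(3) by blast
  qed
  moreover have "countable (\<Union>U\<in>\<U>. {Y \<in> CMin \<theta>. Y \<subseteq> U})"
    using \<open>countable \<U>\<close> by (intro countable_UN) (auto simp: \<U>_def)
  ultimately show ?thesis
    by (rule countable_subset)
qed

section \<open>A Cantor scheme of compact neighbourhoods\<close>

lemma compact_neighbourhood_within:
  fixes X :: "'a::metric_space set"
  assumes "locally_compact_space (euclidean :: 'a topology)" "compact X" "open V" "X \<subseteq> V"
  obtains N where "compact N" "X \<subseteq> interior N" "N \<subseteq> V"
proof -
  have "neighbourhood_base_of (compactin euclidean) (euclidean :: 'a topology)"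
    using assms(1) locally_compact_space_neighbourhood_base[of "euclidean :: 'a topology"]
    by simp
  then have "\<exists>U K. open U \<and> compact K \<and> x \<in> U \<and> U \<subseteq> K \<and> K \<subseteq> V" if "x \<in> X" for x
    using assms(3,4) that unfolding neighbourhood_base_of by (force simp: subset_iff)
  then obtain U K where UK: "\<And>x. x \<in> X \<Longrightarrow> open (U x) \<and> compact (K x) \<and> x \<in> U x \<and> U x \<subseteq> K x \<and> K x \<subseteq> V"
    by metis
  obtain F where F: "F \<subseteq> X" "finite F" "X \<subseteq> (\<Union>x\<in>F. U x)"
    using compactE_image[OF \<open>compact X\<close>, of X U] UK by blast
  show thesis
  proof
    show "compact (\<Union>x\<in>F. K x)"
      using F UK by (intro compact_UN) auto
    have "(\<Union>x\<in>F. U x) \<subseteq> interior (\<Union>x\<in>F. K x)"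
      using F UK by (intro interior_maximal open_UN) blast+
    then show "X \<subseteq> interior (\<Union>x\<in>F. K x)"
      using F(3) by blast
    show "(\<Union>x\<in>F. K x) \<subseteq> V"
      using F UK by blast
  qed
qed

text \<open>
  The invariant of the Cantor scheme. The minimal sets are counted in the interior, so that
  each of them has arbitrarily small neighbourhoods inside \<open>N\<close> and the splitting can be repeated.
\<close>

definition rich :: "(real \<Rightarrow> 'a::metric_space \<Rightarrow> 'a) \<Rightarrow> 'a set \<Rightarrow> bool" where
  "rich \<theta> N \<longleftrightarrow> compact N \<and> uncountable {Y \<in> CMin \<theta>. Y \<subseteq> interior N}"

lemma rich_neighbourhood:
  fixes \<theta> :: "real \<Rightarrow> 'a::metric_space \<Rightarrow> 'a"
  assumes "locally_compact_space (euclidean :: 'a topology)"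
    and "X \<in> CMin \<theta> - sparse_CMin \<theta>" "open V" "X \<subseteq> V"
  obtains N where "rich \<theta> N" "N \<subseteq> V"
proof -
  obtain N where N: "compact N" "X \<subseteq> interior N" "N \<subseteq> V"
    using compact_neighbourhood_within[OF assms(1) _ assms(3,4)] assms(2) CMinD(1) by blast
  have "uncountable {Y \<in> CMin \<theta>. Y \<subseteq> interior N}"
    using assms(2) N(2) by (auto simp: sparse_CMin_iff)
  then show thesis
    using that N by (simp add: rich_def)
qed

text \<open>
  Only countably many minimal sets are sparse, so two different ones in the interior of \<open>N\<close> are
  not. They are disjoint, and a compact neighbourhood of a minimal set that is not sparse is rich.
\<close>

lemma rich_split:
  fixes \<theta> :: "real \<Rightarrow> 'a::metric_space \<Rightarrow> 'a"
  assumes "locally_compact_space (euclidean :: 'a topology)"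
    and "separable_space (euclidean :: 'a topology)"
    and "C0_flow \<theta>" "rich \<theta> N"
  obtains N0 N1 where "rich \<theta> N0" "rich \<theta> N1" "N0 \<subseteq> N" "N1 \<subseteq> N" "N0 \<inter> N1 = {}"
proof -
  let ?S = "{Y \<in> CMin \<theta>. Y \<subseteq> interior N} - sparse_CMin \<theta>"
  have "uncountable ?S"
    using assms countable_sparse_CMin uncountable_minus_countable unfolding rich_def by blast
  then have "infinite ?S"
    using countable_finite by blast
  then obtain X0 X1 where X: "X0 \<in> ?S" "X1 \<in> ?S" "X0 \<noteq> X1"
    by (metis (no_types, lifting) finite.emptyI finite_insert finite_subset insertCI subsetI)
  have "disjnt X0 X1"
    using CMin_disjoint[OF assms(3)] X by (auto simp: disjnt_def)
  moreover have "compact X0" "compact X1"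
    using X CMinD(1) by auto
  ultimately obtain U0 U1 where U: "open U0" "open U1" "X0 \<subseteq> U0" "X1 \<subseteq> U1" "disjnt U0 U1"
    using Hausdorff_space_compact_separation[of "euclidean :: 'a topology" X0 X1]
    by auto
  obtain N0 where N0: "rich \<theta> N0" "N0 \<subseteq> U0 \<inter> interior N"
    using rich_neighbourhood[OF assms(1), of X0 \<theta> "U0 \<inter> interior N"] X U by auto
  obtain N1 where N1: "rich \<theta> N1" "N1 \<subseteq> U1 \<inter> interior N"
    using rich_neighbourhood[OF assms(1), of X1 \<theta> "U1 \<inter> interior N"] X U by auto
  show thesis
    using that N0 N1 U(5) interior_subset[of N] unfolding disjnt_def by blast
qed

text \<open>
  The invariant cores of the \<open>K n\<close> decrease and are nonempty, since the core of \<open>K n\<close> contains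
  \<open>Y n\<close>. Their intersection is therefore a nonempty compact invariant set, even though the sets
  \<open>Y n\<close> need not converge.
\<close>

lemma CMin_in_nested_compacts:
  assumes flow: "C0_flow \<theta>" and K: "\<And>n. compact (K n)" "\<And>n. K (Suc n) \<subseteq> K n"
    and Y: "\<And>n. Y n \<in> CMin \<theta>" "\<And>n. Y n \<subseteq> K n"
  obtains M where "M \<in> CMin \<theta>" "\<And>n. M \<subseteq> K n"
proof -
  let ?C = "\<lambda>n. invariant_core \<theta> (K n)"
  have dec: "K n \<subseteq> K m" if "m \<le> n" for m n
    using K(2) that by (rule lift_Suc_antimono_le)
  have closed: "closed (?C n)" for n
    using K(1) by (intro closed_invariant_core[OF flow] compact_imp_closed)
  have "K 0 \<inter> (\<Inter>n. ?C n) \<noteq> {}"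
  proof (rule compact_imp_fip_image[OF K(1)])
    fix F :: "nat set" assume "finite F"
    define m where "m = Max (insert 0 F)"
    have "Y m \<subseteq> ?C n" if "n \<in> F" for n
    proof -
      have "n \<le> m"
        using \<open>finite F\<close> that by (simp add: m_def)
      then show ?thesis
        using invariant_subset_core[OF flow CMinD(4)[OF Y(1)[of m]]] Y(2)[of m] dec by blast
    qed
    moreover have "Y m \<subseteq> K 0"
      using Y(2)[of m] dec[of 0 m] by blast
    ultimately show "K 0 \<inter> (\<Inter>n\<in>F. ?C n) \<noteq> {}"
      using CMinD(2)[OF Y(1)[of m]] by blast
  qed (rule closed)
  then have "(\<Inter>n. ?C n) \<noteq> {}"
    by blast
  moreover have "compact (\<Inter>n. ?C n)"
  proof -
    have "(\<Inter>n. ?C n) = K 0 \<inter> (\<Inter>n. ?C n)"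
      using invariant_core_subset[OF flow, of "K 0"] by blast
    then show ?thesis
      using compact_Int_closed[OF K(1)[of 0], of "\<Inter>n. ?C n"] closed by (simp add: closed_INT)
  qed
  moreover have "invariant_set \<theta> (\<Inter>n. ?C n)"
    using invariant_set_core[OF flow] by (auto simp: invariant_set_iff[OF flow])
  ultimately obtain M where M: "M \<in> CMin \<theta>" "M \<subseteq> (\<Inter>n. ?C n)"
    using exists_CMin_subset[OF flow] by metis
  show thesis
  proof
    show "M \<subseteq> K n" for n
      using M(2) invariant_core_subset[OF flow, of "K n"] by blast
  qed fact
qed

text \<open>
  The branches of the scheme are indexed by subsets \<open>A\<close> of the natural numbers: at step \<open>n\<close> the
  branch takes one half or the other according to whether \<open>n\<close> belongs to \<open>A\<close>. Two branches are
  separated after the first number on which their index sets disagree.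
\<close>

lemma real_lepoll_CMin_rich:
  fixes \<theta> :: "real \<Rightarrow> 'a::metric_space \<Rightarrow> 'a"
  assumes "locally_compact_space (euclidean :: 'a topology)"
    and "separable_space (euclidean :: 'a topology)"
    and flow: "C0_flow \<theta>" and "rich \<theta> N"
  shows "(UNIV :: real set) \<lesssim> {Y \<in> CMin \<theta>. Y \<subseteq> N}"
proof -
  have "\<exists>h :: bool \<Rightarrow> 'a set. (\<forall>b. rich \<theta> (h b) \<and> h b \<subseteq> L) \<and> h True \<inter> h False = {}"
    if L: "rich \<theta> L" for L
  proof -
    obtain N0 N1 where "rich \<theta> N0" "rich \<theta> N1" "N0 \<subseteq> L" "N1 \<subseteq> L" "N0 \<inter> N1 = {}"
      using rich_split[OF assms(1-3) L] by blast
    then show ?thesis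
      by (intro exI[of _ "\<lambda>b. if b then N0 else N1"]) auto
  qed
  then obtain h :: "'a set \<Rightarrow> bool \<Rightarrow> 'a set"
    where h: "\<And>L b. rich \<theta> L \<Longrightarrow> rich \<theta> (h L b) \<and> h L b \<subseteq> L"
      and disj: "\<And>L. rich \<theta> L \<Longrightarrow> h L True \<inter> h L False = {}"
    by metis
  define K where "K A = rec_nat N (\<lambda>n L. h L (n \<in> A))" for A
  have K0: "K A 0 = N" and KSuc: "K A (Suc n) = h (K A n) (n \<in> A)" for A n
    by (simp_all add: K_def)
  have rich: "rich \<theta> (K A n)" for A n
    by (induction n) (use \<open>rich \<theta> N\<close> h in \<open>auto simp: K0 KSuc\<close>)
  have "\<exists>M\<in>CMin \<theta>. \<forall>n. M \<subseteq> K A n" for A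
  proof -
    have "\<exists>Y. Y \<in> CMin \<theta> \<and> Y \<subseteq> K A n" for n
    proof -
      have "{Y \<in> CMin \<theta>. Y \<subseteq> interior (K A n)} \<noteq> {}"
        using rich[of A n] by (metis countable_empty rich_def)
      then show ?thesis
        using interior_subset by blast
    qed
    then obtain Y where "\<And>n. Y n \<in> CMin \<theta>" "\<And>n. Y n \<subseteq> K A n"
      by metis
    moreover have "compact (K A n)" "K A (Suc n) \<subseteq> K A n" for n
      using rich h by (auto simp: rich_def KSuc)
    ultimately show ?thesis
      using CMin_in_nested_compacts[OF flow] by metis
  qed
  then obtain M where M: "\<And>A. M A \<in> CMin \<theta>" "\<And>A n. M A \<subseteq> K A n"
    by metis
  have "inj M"
  proof (rule injI, rule ccontr)
    fix A B assume eq: "M A = M B" and "A \<noteq> B"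
    then have "\<exists>n. (n \<in> A) \<noteq> (n \<in> B)"
      by blast
    then obtain n where n: "(n \<in> A) \<noteq> (n \<in> B)" and least: "\<And>m. m < n \<Longrightarrow> (m \<in> A) = (m \<in> B)"
      using exists_least_iff[of "\<lambda>n. (n \<in> A) \<noteq> (n \<in> B)"] by auto
    have "K A m = K B m" if "m \<le> n" for m
      using that by (induction m) (auto simp: K0 KSuc least)
    then have "K A n = K B n"
      by simp
    then have "K A (Suc n) \<inter> K B (Suc n) = {}"
      using disj[OF rich[of B n]] n by (cases "n \<in> A") (auto simp: KSuc)
    then show False
      using M(2)[of A "Suc n"] M(2)[of B "Suc n"] CMinD(2)[OF M(1)[of A]] eq by blast
  qed
  moreover have "range M \<subseteq> {Y \<in> CMin \<theta>. Y \<subseteq> N}"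
    using M(1) M(2)[of _ 0] by (auto simp: K0)
  ultimately have "(UNIV :: nat set set) \<lesssim> {Y \<in> CMin \<theta>. Y \<subseteq> N}"
    by (auto simp: lepoll_def)
  then show ?thesis
    using lepoll_trans1[OF eqpoll_sym[OF nat_sets_eqpoll_reals]] by blast
qed

section \<open>The decomposition\<close>

lemma c_dense_CMin_minus_sparse:
  fixes \<theta> :: "real \<Rightarrow> 'a::metric_space \<Rightarrow> 'a"
  assumes "locally_compact_space (euclidean :: 'a topology)"
    and "separable_space (euclidean :: 'a topology)"
    and flow: "C0_flow \<theta>"
  shows "c_dense_in_itself (CMin \<theta> - sparse_CMin \<theta>)"
  unfolding c_dense_in_itself_def
proof (intro conjI ballI allI impI)
  show "CMin \<theta> - sparse_CMin \<theta> \<subseteq> nonvoid_compacts"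
    using CMinD(5) by blast
  fix X and e :: real
  assume X: "X \<in> CMin \<theta> - sparse_CMin \<theta>" and "e > 0"
  then obtain V where V: "open V" "X \<subseteq> V"
    and close: "\<And>Y. Y \<in> CMin \<theta> \<Longrightarrow> Y \<subseteq> V \<Longrightarrow> hausdorff_dist X Y < e"
    using CMin_close_if_subset_open[OF flow] by (metis Diff_iff)
  obtain N where N: "rich \<theta> N" "N \<subseteq> V"
    using rich_neighbourhood[OF assms(1) X V] by blast
  have "(UNIV :: real set) \<lesssim> {Y \<in> CMin \<theta>. Y \<subseteq> N} - sparse_CMin \<theta>"
    using real_lepoll_minus_countable real_lepoll_CMin_rich[OF assms N(1)]
      countable_sparse_CMin[OF assms(2)] by blast
  also have "\<dots> \<lesssim> {Y \<in> CMin \<theta> - sparse_CMin \<theta>. hausdorff_dist X Y < e}"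
    using N(2) close by (intro subset_imp_lepoll) blast
  finally show "(UNIV :: real set) \<lesssim> {Y \<in> CMin \<theta> - sparse_CMin \<theta>. hausdorff_dist X Y < e}" .
qed

text \<open>
  A small Hausdorff ball about \<open>X\<close> consists of minimal sets contained in an open set \<open>V\<close> that
  witnesses sparseness of \<open>X\<close>, and \<open>V\<close> is also a witness for each of them.
\<close>

lemma sparse_CMin_hausdorff_ball:
  assumes "X \<in> sparse_CMin \<theta>"
  obtains e where "e > 0"
    "{Y \<in> CMin \<theta>. hausdorff_dist X Y < e} \<subseteq> sparse_CMin \<theta>"
    "countable {Y \<in> CMin \<theta>. hausdorff_dist X Y < e}"
proof -
  obtain V where X: "X \<in> CMin \<theta>" and V: "open V" "X \<subseteq> V" "countable {Y \<in> CMin \<theta>. Y \<subseteq> V}"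
    using assms by (auto simp: sparse_CMin_iff)
  obtain e where "e > 0" and e: "\<And>Y. Y \<in> nonvoid_compacts \<Longrightarrow> hausdorff_dist X Y < e \<Longrightarrow> Y \<subseteq> V"
    using hausdorff_ball_subset_open[OF CMinD(5)[OF X] V(1,2)] by blast
  have sub: "{Y \<in> CMin \<theta>. hausdorff_dist X Y < e} \<subseteq> {Y \<in> CMin \<theta>. Y \<subseteq> V}"
    using e CMinD(5) by blast
  show thesis
  proof
    show "{Y \<in> CMin \<theta>. hausdorff_dist X Y < e} \<subseteq> sparse_CMin \<theta>"
      using sub V by (force simp: sparse_CMin_iff)
  qed (use \<open>e > 0\<close> countable_subset[OF sub V(3)] in auto)
qed

lemma closedin_CMin_minus_sparse:
  "closedin (Metric_space.mtopology (CMin \<theta>) hausdorff_dist) (CMin \<theta> - sparse_CMin \<theta>)"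
proof -
  interpret Metric_space "CMin \<theta>" hausdorff_dist
    by (rule Metric_space_CMin)
  show ?thesis
    unfolding closedin_metric
  proof (intro conjI allI impI)
    fix X assume "X \<in> CMin \<theta> - (CMin \<theta> - sparse_CMin \<theta>)"
    then obtain e where "e > 0" "{Y \<in> CMin \<theta>. hausdorff_dist X Y < e} \<subseteq> sparse_CMin \<theta>"
      using sparse_CMin_hausdorff_ball by (metis DiffD1 DiffD2 DiffI)
    then show "\<exists>r>0. disjnt (CMin \<theta> - sparse_CMin \<theta>) (mball X r)"
      by (intro exI[of _ e]) (auto simp: disjnt_def mball_def)
  qed auto
qed

lemma c_dense_disjoint_sparse:
  assumes "C \<subseteq> CMin \<theta>" "c_dense_in_itself C"
  shows "C \<inter> sparse_CMin \<theta> = {}"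
proof (rule ccontr)
  assume "C \<inter> sparse_CMin \<theta> \<noteq> {}"
  then obtain X where X: "X \<in> C" "X \<in> sparse_CMin \<theta>"
    by blast
  obtain e where "e > 0" and e: "countable {Y \<in> CMin \<theta>. hausdorff_dist X Y < e}"
    by (rule sparse_CMin_hausdorff_ball[OF X(2)])
  have "countable {Y \<in> C. hausdorff_dist X Y < e}"
    by (rule countable_subset[OF _ e]) (use assms(1) in blast)
  moreover have "(UNIV :: real set) \<lesssim> {Y \<in> C. hausdorff_dist X Y < e}"
    using assms(2) X(1) \<open>e > 0\<close> by (simp add: c_dense_in_itself_def)
  ultimately show False
    using countable_lepoll uncountable_UNIV_real by blast
qed

text \<open>
  Minimal sets are pairwise disjoint, so choosing a point in each embeds them into the space.
\<close>

lemma CMin_lepoll_real: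
  fixes \<theta> :: "real \<Rightarrow> 'a::metric_space \<Rightarrow> 'a"
  assumes "separable_space (euclidean :: 'a topology)" and flow: "C0_flow \<theta>"
  shows "CMin \<theta> \<lesssim> (UNIV :: real set)"
proof -
  have "inj_on (\<lambda>X. SOME x. x \<in> X) (CMin \<theta>)"
  proof (rule inj_onI, rule ccontr)
    fix X Y assume XY: "X \<in> CMin \<theta>" "Y \<in> CMin \<theta>" "X \<noteq> Y"
      and eq: "(SOME x. x \<in> X) = (SOME y. y \<in> Y)"
    have "(SOME x. x \<in> X) \<in> X" "(SOME y. y \<in> Y) \<in> Y"
      using CMinD(2) XY(1,2) by (auto simp: some_in_eq)
    then show False
      using eq CMin_disjoint[OF flow XY] by auto
  qed
  then have "CMin \<theta> \<lesssim> (UNIV :: 'a set)"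
    by (auto simp: lepoll_def)
  also have "(UNIV :: 'a set) \<lesssim> (UNIV :: real set)"
    using separable_imp_countable_base[OF assms(1)] second_countable_lepoll_real by metis
  finally show ?thesis .
qed

theorem theorem3:
  fixes \<theta> :: "real \<Rightarrow> 'a::metric_space \<Rightarrow> 'a"
  assumes "locally_compact_space (euclidean :: 'a topology)"
    and "separable_space (euclidean :: 'a topology)"
    and "C0_flow \<theta>"
    and "uncountable (CMin \<theta>)"
  shows "\<exists>I D. I \<subseteq> CMin \<theta> \<and> countable I \<and> D = CMin \<theta> - I \<and>
      (c_dense_in_itself D \<and>
       closedin (Metric_space.mtopology (CMin \<theta>) hausdorff_dist) D \<and>
       D \<approx> (UNIV :: real set)) \<and>
      (I = {X \<in> CMin \<theta>. \<exists>N. neighbourhood_of N X \<and> countable {Y \<in> CMin \<theta>. Y \<subseteq> N}} \<and>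
       (\<forall>C. C \<subseteq> CMin \<theta> \<and> c_dense_in_itself C \<longrightarrow> C \<subseteq> D))"
proof -
  let ?D = "CMin \<theta> - sparse_CMin \<theta>"
  have I: "countable (sparse_CMin \<theta>)"
    by (rule countable_sparse_CMin[OF assms(2)])
  have dense: "c_dense_in_itself ?D"
    by (rule c_dense_CMin_minus_sparse[OF assms(1-3)])
  have "?D \<approx> (UNIV :: real set)"
  proof (rule lepoll_antisym)
    show "?D \<lesssim> (UNIV :: real set)"
      using CMin_lepoll_real[OF assms(2,3)] lepoll_trans subset_imp_lepoll by blast
    have "?D \<noteq> {}"
      using uncountable_minus_countable[OF assms(4) I] by (metis countable_empty)
    then obtain X where "X \<in> ?D"
      by blast
    then have "(UNIV :: real set) \<lesssim> {Y \<in> ?D. hausdorff_dist X Y < 1}"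
      using dense by (simp add: c_dense_in_itself_def)
    also have "\<dots> \<lesssim> ?D"
      by (intro subset_imp_lepoll) blast
    finally show "(UNIV :: real set) \<lesssim> ?D" .
  qed
  moreover have "C \<subseteq> ?D" if "C \<subseteq> CMin \<theta>" "c_dense_in_itself C" for C
    using c_dense_disjoint_sparse[OF that] that(1) by blast
  moreover have "sparse_CMin \<theta> \<subseteq> CMin \<theta>"
    by (auto simp: sparse_CMin_def)
  ultimately show ?thesis
    using I dense closedin_CMin_minus_sparse[of \<theta>]
    by (intro exI[of _ "sparse_CMin \<theta>"] exI[of _ ?D] conjI)
       (simp_all add: sparse_CMin_def[symmetric])
qed

end
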